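(* Let $\emptyset\neq\mathfrak{T}\subseteq\mathrm{WO}(N)$ be such that $\mathfrak{T}$ is closed in $\mathrm{TO}(N)$ and $A_K^{t,\Phi}$ is multiplicative on $\mathfrak{T}$. Let $L$ be a left ideal of $A$. Then $L$ admits a $\mathfrak{T}$-universal Gröbner basis.
   Context: An algebra of countable type $A_K^{t,\Phi}=(A,K,t,\Phi)$ consists of an associative unital, not necessarily commutative algebra $A$ over a field $K$, a nonnegative integer $t$, and a $K$-module isomorphism $\Phi:A\to K[X]=K[X_1,\dots,X_t]$ (commutative polynomial ring; $\Phi$ need not be multiplicative). $M=\{X^\nu\mid\nu\in\mathbb{N}_0^t\}$ is the set of monomials and $N=\Phi^{-1}(M)$ is the canonical $K$-basis of $A$. For a set $S$, $\mathrm{TO}(S)$ is the set of all total orderings on $S$ (antisymmetric, transitive, total binary relations), with the coarsest topology for which all sets $\mathfrak{U}_{(a,b)}=\{{\preceq}\in\mathrm{TO}(S)\mid a\preceq b\}$ are open. $\mathrm{WO}(S)\subseteq\mathrm{TO}(S)$ is the set of total orderings that are well-orderings. Let $\phi:\mathrm{TO}(N)\to\mathrm{TO}(M)$ be the bijection given by $\Phi(n)\,\phi({\preceq})\,\Phi(n')\Leftrightarrow n\preceq n'$. For ${\preceq}\in\mathrm{TO}(N)$ and $a\in A\setminus\{0\}$, $\mathrm{LM}_\preceq(a)\in M$ is the $\phi({\preceq})$-maximal monomial occurring in $\Phi(a)$ with nonzero coefficient. For $H\subseteq A$, $\mathrm{LM}_\preceq(H)$ is the ideal of $K[X]$ generated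 by $\{\mathrm{LM}_\preceq(h)\mid h\in H\setminus\{0\}\}$. For $\mathfrak{T}\subseteq\mathrm{TO}(N)$, $A_K^{t,\Phi}$ is multiplicative on $\mathfrak{T}$ if $A$ is a domain and $\mathrm{LM}_\preceq(ab)=\mathrm{LM}_\preceq(a)\mathrm{LM}_\preceq(b)$ for all $a,b\in A\setminus\{0\}$ and all ${\preceq}\in\mathfrak{T}$. A Gröbner basis of a left ideal $L$ of $A$ with respect to ${\preceq}\in\mathrm{TO}(N)$ is a finite subset $G\subseteq L$ with $L=\sum_{g\in G}Ag$ and $\mathrm{LM}_\preceq(L)=\mathrm{LM}_\preceq(G)$. A $\mathfrak{T}$-universal Gröbner basis of $L$ is a finite subset of $L$ that is a Gröbner basis of $L$ with respect to every ${\preceq}\in\mathfrak{T}$. *)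

theory Defs
  imports "HOL-Analysis.Analysis" "HOL-Library.Poly_Mapping"
begin

text \<open>
  Exponent vectors are finitely supported functions on \<open>nat\<close>, and the polynomial ring
  $K[X_1,\dots,X_t]$ is the subring of those polynomials in countably many variables
  in which only the variables with index \<open>< t\<close> occur. This keeps \<open>t\<close> an arbitrary natural
  number, including \<open>t = 0\<close>.
\<close>

type_synonym 'k mpoly = "(nat \<Rightarrow>\<^sub>0 nat) \<Rightarrow>\<^sub>0 'k"

definition exponents :: "nat \<Rightarrow> (nat \<Rightarrow>\<^sub>0 nat) set" where
  "exponents t = {\<nu>. Poly_Mapping.keys \<nu> \<subseteq> {..<t}}"

definition polynomials :: "nat \<Rightarrow> 'k::field mpoly set" where
  "polynomials t = {p. Poly_Mapping.keys p \<subseteq> exponents t}"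

definition monom :: "(nat \<Rightarrow>\<^sub>0 nat) \<Rightarrow> 'k::field mpoly" where
  "monom \<nu> = Poly_Mapping.single \<nu> 1"

definition monomials :: "nat \<Rightarrow> 'k::field mpoly set" where
  "monomials t = monom ` exponents t"

definition occurring_monomials :: "'k::field mpoly \<Rightarrow> 'k mpoly set" where
  "occurring_monomials p = monom ` Poly_Mapping.keys p"

definition poly_scale :: "'k::field \<Rightarrow> 'k mpoly \<Rightarrow> 'k mpoly" where
  "poly_scale c p = Poly_Mapping.single 0 c * p"

definition is_poly_ideal :: "nat \<Rightarrow> 'k::field mpoly set \<Rightarrow> bool" where
  "is_poly_ideal t I \<longleftrightarrow> I \<subseteq> polynomials t \<and> 0 \<in> I \<and>
     (\<forall>p\<in>I. \<forall>q\<in>I. p + q \<in> I) \<and> (\<forall>r\<in>polynomials t. \<forall>p\<in>I. r * p \<in> I)"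

definition ideal_generated :: "nat \<Rightarrow> 'k::field mpoly set \<Rightarrow> 'k mpoly set" where
  "ideal_generated t S = is_poly_ideal t hull S"

locale algebra_of_countable_type = Vector_Spaces.linear scale poly_scale \<Phi>
  for scale :: "'k::field \<Rightarrow> 'a::ring_1 \<Rightarrow> 'a"
    and t :: nat
    and \<Phi> :: "'a \<Rightarrow> 'k mpoly" +
  assumes scale_mult_left: "scale c (a * b) = scale c a * b"
    and scale_mult_right: "scale c (a * b) = a * scale c b"
    and bij_Phi: "bij_betw \<Phi> UNIV (polynomials t)"

definition canonical_basis :: "nat \<Rightarrow> ('a \<Rightarrow> 'k::field mpoly) \<Rightarrow> 'a set" where
  "canonical_basis t \<Phi> = \<Phi> -` monomials t"

definition TO :: "'s set \<Rightarrow> 's rel set" where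
  "TO S = {r. linear_order_on S r}"

definition WO :: "'s set \<Rightarrow> 's rel set" where
  "WO S = {r \<in> TO S. well_order_on S r}"

text \<open>
  The whole set \<open>TO S\<close> is added to the subbase only so that the carrier of the topology
  is \<open>TO S\<close> for empty \<open>S\<close>, too.
\<close>

definition TO_topology :: "'s set \<Rightarrow> 's rel topology" where
  "TO_topology S =
     topology_generated_by (insert (TO S) {{r \<in> TO S. (a, b) \<in> r} | a b. a \<in> S \<and> b \<in> S})"

lemma topspace_TO_topology [simp]: "topspace (TO_topology S) = TO S"
  unfolding TO_topology_def topology_generated_by_topspace by auto

definition transport_order :: "('a \<Rightarrow> 'k::field mpoly) \<Rightarrow> 'a rel \<Rightarrow> 'k mpoly rel" where
  "transport_order \<Phi> r = {(\<Phi> n, \<Phi> n') | n n'. (n, n') \<in> r}"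

definition lead_monom :: "('a \<Rightarrow> 'k::field mpoly) \<Rightarrow> 'a rel \<Rightarrow> 'a \<Rightarrow> 'k mpoly" where
  "lead_monom \<Phi> r a = (THE m. m \<in> occurring_monomials (\<Phi> a) \<and>
     (\<forall>m'\<in>occurring_monomials (\<Phi> a). (m', m) \<in> transport_order \<Phi> r))"

definition lead_ideal ::
    "nat \<Rightarrow> ('a::ring_1 \<Rightarrow> 'k::field mpoly) \<Rightarrow> 'a rel \<Rightarrow> 'a set \<Rightarrow> 'k mpoly set" where
  "lead_ideal t \<Phi> r H = ideal_generated t (lead_monom \<Phi> r ` (H - {0}))"

text \<open>For a domain, nontriviality is part of the type class \<open>ring_1\<close>.\<close>

definition multiplicative_on ::
    "('a::ring_1 \<Rightarrow> 'k::field mpoly) \<Rightarrow> 'a rel set \<Rightarrow> bool" where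
  "multiplicative_on \<Phi> T \<longleftrightarrow>
     (\<forall>a b::'a. a * b = 0 \<longrightarrow> a = 0 \<or> b = 0) \<and>
     (\<forall>a b. \<forall>r\<in>T. a \<noteq> 0 \<longrightarrow> b \<noteq> 0 \<longrightarrow>
        lead_monom \<Phi> r (a * b) = lead_monom \<Phi> r a * lead_monom \<Phi> r b)"

definition left_ideal :: "'a::ring_1 set \<Rightarrow> bool" where
  "left_ideal L \<longleftrightarrow> 0 \<in> L \<and> (\<forall>x\<in>L. \<forall>y\<in>L. x + y \<in> L) \<and> (\<forall>a. \<forall>x\<in>L. a * x \<in> L)"

definition left_span :: "'a::ring_1 set \<Rightarrow> 'a set" where
  "left_span G = {\<Sum>g\<in>G. c g * g | c. True}"

definition groebner_basis ::
    "nat \<Rightarrow> ('a::ring_1 \<Rightarrow> 'k::field mpoly) \<Rightarrow> 'a rel \<Rightarrow> 'a set \<Rightarrow> 'a set \<Rightarrow> bool" where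
  "groebner_basis t \<Phi> r L G \<longleftrightarrow> finite G \<and> G \<subseteq> L \<and> L = left_span G \<and>
     lead_ideal t \<Phi> r L = lead_ideal t \<Phi> r G"

definition universal_groebner_basis ::
    "nat \<Rightarrow> ('a::ring_1 \<Rightarrow> 'k::field mpoly) \<Rightarrow> 'a rel set \<Rightarrow> 'a set \<Rightarrow> 'a set \<Rightarrow> bool" where
  "universal_groebner_basis t \<Phi> T L G \<longleftrightarrow> finite G \<and> G \<subseteq> L \<and>
     (\<forall>r\<in>T. groebner_basis t \<Phi> r L G)"

end

theory Submission
  imports Defs
begin

text \<open>
  For a single well-ordering \<open>r\<close>, Dickson's lemma gives a finite \<open>F \<subseteq> L\<close> whose leading exponents
  generate those of \<open>L\<close>. If \<open>r'\<close> selects the same leading exponents on \<open>F\<close>, the leading exponents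
  of \<open>L\<close> for \<open>r\<close> are among those for \<open>r'\<close>; since the complement of either set indexes a basis of
  \<open>A / L\<close>, the two sets agree, and \<open>F\<close> works for \<open>r'\<close> as well. Such \<open>r'\<close> form an open
  neighbourhood of \<open>r\<close>. As a closed subset of the compact space of total orderings, \<open>T\<close> is covered by
  finitely many of these neighbourhoods, and the union of the corresponding \<open>F\<close> is universal.
\<close>

abbreviation "lookup \<equiv> Poly_Mapping.lookup"
abbreviation "keys \<equiv> Poly_Mapping.keys"

section \<open>Compactness of the space of total orderings\<close>

text \<open>Encoding a relation by its indicator function places the orderings in a product of
  two-point discrete spaces, compact by Tychonoff. The order axioms cut out a closed subset, and
  \<open>Collect\<close> maps it continuously onto \<open>TO S\<close>.\<close>

lemma compactin_TO_topology: "compactin (TO_topology S) (TO S)"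
proof -
  define P where "P = product_topology (\<lambda>_::'a \<times> 'a. discrete_topology (UNIV::bool set)) UNIV"
  have top: "topspace P = UNIV"
    by (simp add: P_def)
  have compP: "compact_space P"
    unfolding P_def by (simp add: compact_space_product_topology compact_space_discrete_topology)
  have cont: "continuous_map P (discrete_topology UNIV) (\<lambda>f. f p)" for p
    unfolding P_def by (rule continuous_map_product_coordinates) simp
  have op: "openin P {f. f p}" for p
    using openin_continuous_map_preimage[OF cont[of p], of "{True}"] by (simp add: top)
  have clp: "closedin P {f. f p}" for p
    using closedin_continuous_map_preimage[OF cont[of p], of "{True}"] by (simp add: top)
  have cln: "closedin P {f. \<not> f p}" for p
    using closedin_continuous_map_preimage[OF cont[of p], of "{False}"] by (simp add: top)
  \<comment> \<open>Closed conditions are stable under finite disjunctions and arbitrary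
    conjunctions. Since literals are closed by \<open>clp\<close> and \<open>cln\<close>, every
    universally quantified clause in coordinates is closed.\<close>
  have disj: "closedin P {f. A f \<or> B f}"
    if "closedin P {f. A f}" "closedin P {f. B f}" for A B
    using closedin_Un[OF that] by (simp add: Collect_disj_eq)
  have conj: "closedin P {f. A f \<and> B f}"
    if "closedin P {f. A f}" "closedin P {f. B f}" for A B
    using closedin_Int[OF that] by (simp add: Collect_conj_eq)
  have all: "closedin P {f. \<forall>x. A x f}"
    if "\<And>x. closedin P {f. A x f}" for A :: "'a \<Rightarrow> ('a \<times> 'a \<Rightarrow> bool) \<Rightarrow> bool"
    using closedin_Inter[of "range (\<lambda>x. {f. A x f})" P] that
    by (auto simp: Collect_all_eq)
  have const: "closedin P {f. b}" for b
    using closedin_topspace[of P] by (cases b) (auto simp: top)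
  define X where "X = {f. linear_order_on S {p. f p}}"
  \<comment> \<open>The axioms are put in a form where negation stands only before coordinates or
    parts independent of \<open>f\<close>, so that the closure rules apply along the syntax.\<close>
  have X_eq: "X = {f. (\<forall>x y. (x \<in> S \<and> y \<in> S) \<or> \<not> f (x, y)) \<and> (\<forall>x. x \<notin> S \<or> f (x, x)) \<and>
      (\<forall>x y z. (\<not> f (x, y) \<or> \<not> f (y, z)) \<or> f (x, z)) \<and>
      (\<forall>x y. (\<not> f (x, y) \<or> \<not> f (y, x)) \<or> x = y) \<and>
      (\<forall>x. x \<notin> S \<or> (\<forall>y. y \<notin> S \<or> x = y \<or> f (x, y) \<or> f (y, x)))}"
    unfolding X_def order_on_defs refl_on_def trans_def antisym_def total_on_def
      subset_iff Ball_def split_paired_All mem_Sigma_iff mem_Collect_eq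
    by (simp only: conj_assoc imp_conv_disj de_Morgan_conj disj_assoc not_not) (simp only: disj_ac conj_ac simp_thms)
  have "closedin P X"
    unfolding X_eq by (intro conj all disj const clp cln)
  then have "compactin P X"
    using compP by (simp add: closedin_compact_space)
  moreover have "continuous_map (subtopology P X) (TO_topology S) Collect"
    unfolding TO_topology_def
  proof (rule continuous_on_generated_topo)
    show "Collect ` topspace (subtopology P X) \<subseteq>
      \<Union> (insert (TO S) {{r \<in> TO S. (a, b) \<in> r} |a b. a \<in> S \<and> b \<in> S})"
      by (auto simp: X_def TO_def top)
  next
    fix U assume "U \<in> insert (TO S) {{r \<in> TO S. (a, b) \<in> r} |a b. a \<in> S \<and> b \<in> S}"
    then consider "U = TO S" | a b where "U = {r \<in> TO S. (a, b) \<in> r}"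
      by blast
    then show "openin (subtopology P X) (Collect -` U \<inter> topspace (subtopology P X))"
    proof cases
      case 1
      then have "Collect -` U \<inter> topspace (subtopology P X) = topspace (subtopology P X)"
        by (auto simp: X_def TO_def top)
      then show ?thesis
        by (metis openin_topspace)
    next
      case 2
      then have "Collect -` U \<inter> topspace (subtopology P X) = {f. f (a, b)} \<inter> X"
        by (auto simp: X_def TO_def top)
      then show ?thesis
        using op by (simp add: openin_subtopology) blast
    qed
  qed
  ultimately have "compactin (TO_topology S) (Collect ` X)"
    by (meson compactin_subtopology image_compactin order_refl)
  moreover have "Collect ` X = TO S"
  proof
    show "TO S \<subseteq> Collect ` X"
    proof
      fix r assume "r \<in> TO S"
      then have "(\<lambda>p. p \<in> r) \<in> X" "r = Collect (\<lambda>p. p \<in> r)"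
        by (auto simp: X_def TO_def)
      then show "r \<in> Collect ` X" by blast
    qed
  qed (auto simp: X_def TO_def)
  ultimately show ?thesis by simp
qed

section \<open>Dickson's lemma\<close>

text \<open>Coordinates are treated one after another: a further subsequence makes the next
  coordinate increasing and keeps the earlier ones increasing.\<close>

lemma exponents_monotone_subseq:
  fixes s :: "nat \<Rightarrow> (nat \<Rightarrow>\<^sub>0 nat)"
  shows "\<exists>f::nat \<Rightarrow> nat. strict_mono f \<and>
    (\<forall>i<t. \<forall>m n. m \<le> n \<longrightarrow> lookup (s (f m)) i \<le> lookup (s (f n)) i)"
proof (induction t)
  case 0
  have "strict_mono (id::nat \<Rightarrow> nat)"
    by (simp add: strict_mono_def)
  then show ?case by blast
next
  case (Suc t)
  then obtain f :: "nat \<Rightarrow> nat" where f: "strict_mono f"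
    "\<And>i m n. i < t \<Longrightarrow> m \<le> n \<Longrightarrow> lookup (s (f m)) i \<le> lookup (s (f n)) i"
    by blast
  define u where "u = (\<lambda>n. lookup (s (f n)) t)"
  have "\<exists>g::nat \<Rightarrow> nat. strict_mono g \<and> incseq (u \<circ> g)"
  proof -
    obtain g where g: "strict_mono g" "monoseq (u \<circ> g)"
      using seq_monosub[of u] by (auto simp: comp_def)
    from g(2) consider "incseq (u \<circ> g)" | "decseq (u \<circ> g)"
      by (auto simp: monoseq_iff)
    then show ?thesis
    proof cases
      case 1
      with g show ?thesis by blast
    next
      case 2
      \<comment> \<open>A decreasing sequence of naturals is constant once it attains its minimum
        \<open>k\<close>, so dropping the first \<open>N\<close> terms makes it increasing.\<close>
      define k where "k = (LEAST x. x \<in> range (u \<circ> g))"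
      have "k \<in> range (u \<circ> g)"
        unfolding k_def by (rule LeastI[of _ "(u \<circ> g) 0"]) blast
      then obtain N where N: "(u \<circ> g) N = k" by auto
      have least: "k \<le> (u \<circ> g) n" for n
        unfolding k_def by (rule Least_le) blast
      have "(u \<circ> g) (N + n) = k" for n
        using decseqD[OF 2, of N "N + n"] N least[of "N + n"] by simp
      then have "incseq (u \<circ> (g \<circ> (+) N))"
        by (simp add: incseq_def)
      moreover have "strict_mono (g \<circ> (+) N)"
        using g(1) by (simp add: strict_mono_def)
      ultimately show ?thesis by blast
    qed
  qed
  then obtain g :: "nat \<Rightarrow> nat" where g: "strict_mono g" "incseq (u \<circ> g)" by blast
  have "strict_mono (f \<circ> g)"
    using f(1) g(1) by (simp add: strict_mono_def)
  moreover have "lookup (s ((f \<circ> g) m)) i \<le> lookup (s ((f \<circ> g) n)) i"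
    if "i < Suc t" "m \<le> n" for i m n
  proof (cases "i = t")
    case True
    then show ?thesis
      using incseqD[OF g(2) \<open>m \<le> n\<close>] by (simp add: u_def)
  next
    case False
    then show ?thesis
      using f(2)[of i "g m" "g n"] that monoD[OF strict_mono_mono[OF g(1)] \<open>m \<le> n\<close>] by simp
  qed
  ultimately show ?case by blast
qed

text \<open>The minimal elements for the componentwise order form the finite set. Infinitely many of
  them would contain two distinct comparable ones by the monotone subsequence.\<close>

lemma dickson:
  assumes E: "E \<subseteq> exponents t"
  shows "\<exists>F\<subseteq>E. finite F \<and> (\<forall>e\<in>E. \<exists>f\<in>F. \<exists>d\<in>exponents t. e = f + d)"
proof -
  define le where "le f e \<longleftrightarrow> (\<forall>i. lookup f i \<le> lookup e i)" for f e :: "nat \<Rightarrow>\<^sub>0 nat"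
  define F where "F = {e \<in> E. \<forall>f\<in>E. le f e \<longrightarrow> f = e}"
  have out: "lookup e i = 0" if "e \<in> E" "\<not> i < t" for e i
    using that E by (force simp: exponents_def in_keys_iff)
  have fin: "finite F"
  proof (rule ccontr)
    assume "infinite F"
    then obtain s :: "nat \<Rightarrow> _" where s: "inj s" "range s \<subseteq> F"
      using infinite_countable_subset by blast
    obtain f :: "nat \<Rightarrow> nat" where f: "strict_mono f"
      "\<And>i m n. i < t \<Longrightarrow> m \<le> n \<Longrightarrow> lookup (s (f m)) i \<le> lookup (s (f n)) i"
      using exponents_monotone_subseq[of t s] by blast
    have mem: "s n \<in> F" for n using s(2) by blast
    then have memE: "s n \<in> E" for n by (simp add: F_def)
    have "le (s (f 0)) (s (f 1))"
      unfolding le_def using f(2)[of _ 0 1] out[OF memE] by (metis le0 le_refl)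
    with mem memE have "s (f 0) = s (f 1)"
      by (simp add: F_def)
    then have "f 0 = f 1" using s(1) by (simp add: inj_eq)
    with f(1) show False by (simp add: strict_mono_eq)
  qed
  have dom: "\<exists>f\<in>F. le f e" if "e \<in> E" for e
    using that
  \<comment> \<open>Descent on total degree: a non-minimal \<open>e\<close> lies above some
    \<open>g\<close> in \<open>E\<close> of strictly smaller degree. Coordinates from
    \<open>t\<close> on vanish by \<open>out\<close>, so they hide no difference.\<close>
  proof (induction "\<Sum>i<t. lookup e i" arbitrary: e rule: less_induct)
    case less
    show ?case
    proof (cases "e \<in> F")
      case True
      then show ?thesis by (auto simp: le_def)
    next
      case False
      then obtain g where g: "g \<in> E" "le g e" "g \<noteq> e"
        using less.prems by (auto simp: F_def)
      then obtain i where i: "lookup g i \<noteq> lookup e i"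
        by (meson poly_mapping_eqI)
      then have "i < t" using out[OF g(1)] out[OF less.prems] by metis
      then have "(\<Sum>i<t. lookup g i) < (\<Sum>i<t. lookup e i)"
        using g(2) i by (intro sum_strict_mono_ex1) (auto simp: le_def intro!: bexI[of _ i] le_neq_implies_less)
      then obtain f where "f \<in> F" "le f g" using less.hyps g(1) by blast
      with g(2) show ?thesis unfolding le_def by (meson order_trans)
    qed
  qed
  \<comment> \<open>Subtraction of exponents is truncated at zero; \<open>le f e\<close> ensures
    that it really gives the quotient exponent.\<close>
  have diff: "\<exists>d\<in>exponents t. e = f + d" if "le f e" "e \<in> E" for e f
  proof (rule bexI)
    show "e = f + (e - f)"
      using that(1) by (intro poly_mapping_eqI) (simp add: lookup_add lookup_minus le_def)
    show "e - f \<in> exponents t"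
      unfolding exponents_def
    proof (intro CollectI subsetI, rule ccontr)
      fix i assume "i \<in> keys (e - f)" "i \<notin> {..<t}"
      then show False
        using out[OF that(2), of i] by (simp add: in_keys_iff lookup_minus)
    qed
  qed
  show ?thesis
  proof (intro exI conjI ballI)
    show "F \<subseteq> E" by (simp add: F_def)
    show "finite F" by (fact fin)
    show "\<exists>f\<in>F. \<exists>d\<in>exponents t. e = f + d" if "e \<in> E" for e
      using dom[OF that] diff that by meson
  qed
qed

section \<open>Monomials, left ideals and generated polynomial ideals\<close>

lemma inj_monom: "inj (monom :: _ \<Rightarrow> 'k::field mpoly)"
  by (rule injI) (metis keys_single monom_def singleton_inject zero_neq_one)

lemma keys_monom: "keys (monom \<nu> :: 'k::field mpoly) = {\<nu>}"
  by (simp add: monom_def)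

lemma monom_mult: "monom \<nu> * monom \<mu> = (monom (\<nu> + \<mu>) :: 'k::field mpoly)"
  by (simp add: monom_def mult_single)

lemma lookup_poly_scale: "lookup (poly_scale c p) \<nu> = c * lookup p \<nu>"
  unfolding poly_scale_def mult_map_scale_conv_mult[symmetric]
  by (simp add: map.rep_eq when_def)

lemma left_ideal_sum:
  assumes "left_ideal L" "\<And>g. g \<in> G \<Longrightarrow> f g \<in> L"
  shows "sum f G \<in> L"
  using assms(2)
  by (induction G rule: infinite_finite_induct) (use assms(1) in \<open>auto simp: left_ideal_def\<close>)

lemma left_ideal_left_span: "left_ideal (left_span G)"
  unfolding left_ideal_def
proof (intro conjI ballI allI)
  show "0 \<in> left_span G"
    unfolding left_span_def by (rule CollectI, rule exI[of _ "\<lambda>_. 0"]) simp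
next
  fix x y assume "x \<in> left_span G" "y \<in> left_span G"
  then obtain c d where "x = (\<Sum>g\<in>G. c g * g)" "y = (\<Sum>g\<in>G. d g * g)"
    unfolding left_span_def by blast
  then have "x + y = (\<Sum>g\<in>G. (c g + d g) * g)"
    by (simp add: sum.distrib distrib_right)
  then show "x + y \<in> left_span G"
    unfolding left_span_def by (intro CollectI exI[of _ "\<lambda>g. c g + d g"]) simp
next
  fix a x assume "x \<in> left_span G"
  then obtain c where "x = (\<Sum>g\<in>G. c g * g)"
    unfolding left_span_def by blast
  then have "a * x = (\<Sum>g\<in>G. (a * c g) * g)"
    by (simp add: sum_distrib_left mult.assoc)
  then show "a * x \<in> left_span G"
    unfolding left_span_def by (intro CollectI exI[of _ "\<lambda>g. a * c g"]) simp
qed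

lemma subset_left_span:
  assumes "finite G"
  shows "G \<subseteq> left_span G"
proof
  fix x assume "x \<in> G"
  have "(\<Sum>g\<in>G. (if g = x then 1 else 0) * g) = (\<Sum>g\<in>G. if g = x then x else 0)"
    by (rule sum.cong) auto
  also have "\<dots> = x"
    using assms \<open>x \<in> G\<close> by simp
  finally have "x = (\<Sum>g\<in>G. (if g = x then 1 else 0) * g)" ..
  then show "x \<in> left_span G"
    unfolding left_span_def by (intro CollectI exI[of _ "\<lambda>g. if g = x then 1 else 0"]) simp
qed

lemma left_span_subset:
  assumes "left_ideal L" "G \<subseteq> L"
  shows "left_span G \<subseteq> L"
  unfolding left_span_def
  using assms by (auto intro!: left_ideal_sum) (auto simp: left_ideal_def)

text \<open>The hypothesis makes the polynomial ring itself one of the intersected ideals. Otherwise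
  the hull would be an empty intersection, that is, the whole type.\<close>

lemma is_poly_ideal_ideal_generated:
  assumes "S \<subseteq> polynomials t"
  shows "is_poly_ideal t (ideal_generated t S)"
proof -
  have add: "p + q \<in> polynomials t" if "p \<in> polynomials t" "q \<in> polynomials t" for p q :: "'a mpoly"
    using that keys_add[of p q] by (auto simp: polynomials_def)
  have exp_add: "\<nu> + \<mu> \<in> exponents t" if "\<nu> \<in> exponents t" "\<mu> \<in> exponents t" for \<nu> \<mu>
    using that keys_add[of \<nu> \<mu>] by (auto simp: exponents_def)
  have mult: "p * q \<in> polynomials t" if "p \<in> polynomials t" "q \<in> polynomials t" for p q :: "'a mpoly"
    using that keys_mult[of p q] exp_add by (fastforce simp: polynomials_def)
  have poly: "is_poly_ideal t (polynomials t :: 'a mpoly set)"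
    unfolding is_poly_ideal_def using add mult by (auto simp: polynomials_def)
  have sub: "ideal_generated t S \<subseteq> polynomials t"
    unfolding ideal_generated_def using assms poly by (rule hull_minimal)
  have hullE: "x \<in> ideal_generated t S \<longleftrightarrow> (\<forall>I. is_poly_ideal t I \<and> S \<subseteq> I \<longrightarrow> x \<in> I)" for x
    unfolding ideal_generated_def hull_def by blast
  show ?thesis
    unfolding is_poly_ideal_def
  proof (intro conjI ballI sub)
    show "0 \<in> ideal_generated t S"
      unfolding hullE by (simp add: is_poly_ideal_def)
    show "p + q \<in> ideal_generated t S" if "p \<in> ideal_generated t S" "q \<in> ideal_generated t S" for p q
      using that unfolding hullE by (simp add: is_poly_ideal_def)
    show "q * p \<in> ideal_generated t S" if "q \<in> polynomials t" "p \<in> ideal_generated t S" for p q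
      using that unfolding hullE by (simp add: is_poly_ideal_def)
  qed
qed

section \<open>Leading exponents and remainders\<close>

context algebra_of_countable_type
begin

text \<open>For \<nu> outside \<open>exponents t\<close> the value of \<open>inv\<close> is
  unspecified, whence the membership hypotheses in what follows.\<close>

definition basis :: "(nat \<Rightarrow>\<^sub>0 nat) \<Rightarrow> 'a" where
  "basis \<nu> = inv \<Phi> (monom \<nu>)"

definition le_exp :: "'a rel \<Rightarrow> (nat \<Rightarrow>\<^sub>0 nat) \<Rightarrow> (nat \<Rightarrow>\<^sub>0 nat) \<Rightarrow> bool" where
  "le_exp r \<mu> \<nu> \<longleftrightarrow> (basis \<mu>, basis \<nu>) \<in> r"

text \<open>A relational substitute for the description operator in \<open>lead_monom\<close>, on
  the level of exponents; existence and uniqueness are separate lemmas.\<close>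

definition is_lead :: "'a rel \<Rightarrow> 'a \<Rightarrow> (nat \<Rightarrow>\<^sub>0 nat) \<Rightarrow> bool" where
  "is_lead r a \<nu> \<longleftrightarrow> \<nu> \<in> keys (\<Phi> a) \<and> (\<forall>\<mu>\<in>keys (\<Phi> a). le_exp r \<mu> \<nu>)"

abbreviation "N \<equiv> canonical_basis t \<Phi>"

lemma inj_Phi: "inj \<Phi>"
  using bij_Phi by (simp add: bij_betw_def)

lemma Phi_eq_0_iff: "\<Phi> a = 0 \<longleftrightarrow> a = 0"
  using inj_Phi zero by (metis injD)

lemma keys_Phi_subset: "keys (\<Phi> a) \<subseteq> exponents t"
  using bij_Phi by (auto simp: bij_betw_def polynomials_def)

lemma Phi_basis: "\<nu> \<in> exponents t \<Longrightarrow> \<Phi> (basis \<nu>) = monom \<nu>"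
  unfolding basis_def
  by (rule f_inv_into_f) (use bij_Phi in \<open>auto simp: bij_betw_def polynomials_def keys_monom\<close>)

lemma basis_in_N: "\<nu> \<in> exponents t \<Longrightarrow> basis \<nu> \<in> N"
  by (simp add: canonical_basis_def monomials_def Phi_basis)

lemma basis_inject: "\<nu> \<in> exponents t \<Longrightarrow> \<mu> \<in> exponents t \<Longrightarrow> basis \<nu> = basis \<mu> \<longleftrightarrow> \<nu> = \<mu>"
  by (metis Phi_basis inj_monom injD)

lemma lookup_Phi_diff: "lookup (\<Phi> (a - scale c b)) \<nu> = lookup (\<Phi> a) \<nu> - c * lookup (\<Phi> b) \<nu>"
  by (simp add: diff scale lookup_minus lookup_poly_scale)

lemma lookup_Phi_add: "lookup (\<Phi> (a + scale c b)) \<nu> = lookup (\<Phi> a) \<nu> + c * lookup (\<Phi> b) \<nu>"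
  by (simp add: add scale lookup_add lookup_poly_scale)

lemma left_ideal_scale: "left_ideal L \<Longrightarrow> x \<in> L \<Longrightarrow> scale c x \<in> L"
  using scale_mult_left[of c 1 x] by (simp add: left_ideal_def)

lemma left_ideal_diff:
  assumes "left_ideal L" "x \<in> L" "y \<in> L"
  shows "x - y \<in> L"
proof -
  have "x + (-1) * y \<in> L"
    using assms unfolding left_ideal_def by blast
  then show ?thesis by simp
qed

lemma TO_linear:
  assumes "r \<in> TO N"
  shows le_exp_refl: "\<nu> \<in> exponents t \<Longrightarrow> le_exp r \<nu> \<nu>"
    and le_exp_trans: "le_exp r \<nu> \<mu> \<Longrightarrow> le_exp r \<mu> \<xi> \<Longrightarrow> le_exp r \<nu> \<xi>"
    and le_exp_antisym: "\<nu> \<in> exponents t \<Longrightarrow> \<mu> \<in> exponents t \<Longrightarrow>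
      le_exp r \<nu> \<mu> \<Longrightarrow> le_exp r \<mu> \<nu> \<Longrightarrow> \<nu> = \<mu>"
    and le_exp_total: "\<nu> \<in> exponents t \<Longrightarrow> \<mu> \<in> exponents t \<Longrightarrow> le_exp r \<nu> \<mu> \<or> le_exp r \<mu> \<nu>"
proof -
  have r: "refl_on N r" "trans r" "antisym r" "total_on N r"
    using assms by (auto simp: TO_def order_on_defs)
  show refl: "le_exp r \<nu> \<nu>" if "\<nu> \<in> exponents t" for \<nu>
    using r(1) basis_in_N[OF that] by (auto simp: le_exp_def refl_on_def)
  show "le_exp r \<nu> \<mu> \<Longrightarrow> le_exp r \<mu> \<xi> \<Longrightarrow> le_exp r \<nu> \<xi>"
    using r(2) unfolding le_exp_def by (rule transD)
  show "\<nu> = \<mu>" if "\<nu> \<in> exponents t" "\<mu> \<in> exponents t" "le_exp r \<nu> \<mu>" "le_exp r \<mu> \<nu>"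
    using r(3) that basis_inject unfolding le_exp_def by (metis antisymD)
  show "le_exp r \<nu> \<mu> \<or> le_exp r \<mu> \<nu>" if "\<nu> \<in> exponents t" "\<mu> \<in> exponents t"
    using r(4) basis_in_N that refl unfolding le_exp_def total_on_def by metis
qed

lemma is_lead_in_exponents: "is_lead r a \<nu> \<Longrightarrow> \<nu> \<in> exponents t"
  using keys_Phi_subset by (auto simp: is_lead_def)

lemma is_lead_nonzero: "is_lead r a \<nu> \<Longrightarrow> a \<noteq> 0"
  by (auto simp: is_lead_def)

lemma is_lead_unique:
  assumes "r \<in> TO N" "is_lead r a \<nu>" "is_lead r a \<mu>"
  shows "\<nu> = \<mu>"
  using assms(2,3) is_lead_in_exponents[OF assms(2)] is_lead_in_exponents[OF assms(3)]
  by (auto simp: is_lead_def intro: le_exp_antisym[OF assms(1)])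

lemma is_lead_exists:
  assumes r: "r \<in> TO N" and "a \<noteq> 0"
  obtains \<nu> where "is_lead r a \<nu>"
proof -
  have "\<exists>\<nu>\<in>K. \<forall>\<mu>\<in>K. le_exp r \<mu> \<nu>" if "finite K" "K \<noteq> {}" "K \<subseteq> exponents t" for K
    using that
  proof (induction rule: finite_ne_induct)
    case (singleton \<nu>)
    then show ?case using le_exp_refl[OF r] by simp
  next
    case (insert \<xi> K)
    then obtain \<nu> where \<nu>: "\<nu> \<in> K" "\<forall>\<mu>\<in>K. le_exp r \<mu> \<nu>" by auto
    have "\<xi> \<in> exponents t" "\<nu> \<in> exponents t" using insert.prems \<nu> by auto
    then consider "le_exp r \<xi> \<nu>" | "le_exp r \<nu> \<xi>"
      using le_exp_total[OF r] by blast
    then show ?case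
    proof cases
      case 1
      with \<nu> show ?thesis by auto
    next
      case 2
      with \<nu> show ?thesis
        using le_exp_refl[OF r \<open>\<xi> \<in> exponents t\<close>] le_exp_trans[OF r]
        by (intro bexI[of _ \<xi>]) auto
    qed
  qed
  from this[of "keys (\<Phi> a)"] show ?thesis
    using that assms(2) keys_Phi_subset by (auto simp: is_lead_def Phi_eq_0_iff)
qed

text \<open>The bridge from exponents back to monomials: injectivity of \<Phi> makes the transported
  order on monomials the same as \<open>le_exp\<close>.\<close>

lemma lead_monom_eq:
  assumes r: "r \<in> TO N" and lead: "is_lead r a \<nu>"
  shows "lead_monom \<Phi> r a = monom \<nu>"
proof -
  have tr: "(monom \<mu>, monom \<xi>) \<in> transport_order \<Phi> r \<longleftrightarrow> le_exp r \<mu> \<xi>"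
    if "\<mu> \<in> exponents t" "\<xi> \<in> exponents t" for \<mu> \<xi>
    unfolding transport_order_def le_exp_def
    using Phi_basis[OF that(1)] Phi_basis[OF that(2)] inj_Phi
    by (auto simp: inj_def) metis+
  have iff: "m \<in> occurring_monomials (\<Phi> a) \<and>
      (\<forall>m'\<in>occurring_monomials (\<Phi> a). (m', m) \<in> transport_order \<Phi> r) \<longleftrightarrow>
      (\<exists>\<mu>. m = monom \<mu> \<and> is_lead r a \<mu>)" for m
    using tr keys_Phi_subset[of a]
    by (auto simp: occurring_monomials_def is_lead_def subset_iff)
  show ?thesis
    unfolding lead_monom_def iff
    using lead is_lead_unique[OF r] by (intro the_equality) auto
qed

text \<open>The domain property keeps the product nonzero, so it has a leading exponent; injectivity
  of \<open>monom\<close> turns the product of leading monomials into a sum of exponents.\<close>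

lemma is_lead_mult:
  assumes "multiplicative_on \<Phi> T" "r \<in> T" "r \<in> TO N" "is_lead r a \<nu>" "is_lead r b \<mu>"
  shows "is_lead r (a * b) (\<nu> + \<mu>)"
proof -
  have nz: "a \<noteq> 0" "b \<noteq> 0"
    using assms(4,5) is_lead_nonzero by auto
  then have "a * b \<noteq> 0"
    using assms(1) by (auto simp: multiplicative_on_def)
  then obtain \<xi> where \<xi>: "is_lead r (a * b) \<xi>"
    using is_lead_exists[OF assms(3)] by blast
  have "lead_monom \<Phi> r (a * b) = lead_monom \<Phi> r a * lead_monom \<Phi> r b"
    using assms(1,2) nz by (simp add: multiplicative_on_def)
  then have "(monom \<xi> :: 'k mpoly) = monom (\<nu> + \<mu>)"
    using assms(3-5) \<xi> by (simp add: lead_monom_eq monom_mult)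
  then have "\<xi> = \<nu> + \<mu>"
    using inj_monom by (metis injD)
  with \<xi> show ?thesis by simp
qed

lemma is_lead_basis:
  assumes "r \<in> TO N" "\<nu> \<in> exponents t"
  shows "is_lead r (basis \<nu>) \<nu>"
  using assms le_exp_refl by (auto simp: is_lead_def Phi_basis keys_monom)

text \<open>Remainders modulo \<open>L\<close>, where \<open>E\<close> is any set of leading exponents of \<open>L\<close>; the bound
  on the exponents of the remainder is what prevents cancellation with a larger leading term.\<close>

lemma normal_form:
  assumes r: "r \<in> WO N" and L: "left_ideal L"
    and E: "\<And>\<nu>. \<nu> \<in> E \<Longrightarrow> \<exists>g\<in>L. is_lead r g \<nu>"
    and "\<nu> \<in> exponents t" "\<forall>\<mu>\<in>keys (\<Phi> a). le_exp r \<mu> \<nu>"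
  shows "\<exists>b. a - b \<in> L \<and> keys (\<Phi> b) \<inter> E = {} \<and> (\<forall>\<mu>\<in>keys (\<Phi> b). le_exp r \<mu> \<nu>)"
proof -
  have TO: "r \<in> TO N" using r by (simp add: WO_def)
  \<comment> \<open>The induction runs over the bound \<nu>, along the strict part of the
    well-ordering pulled back to exponents.\<close>
  have "wf (inv_image (r - Id) basis)"
    using r by (auto simp: WO_def well_order_on_def)
  then show ?thesis
    using assms(4,5)
  proof (induction \<nu> arbitrary: a)
    case (less \<nu>)
    \<comment> \<open>Once the term at \<nu> is gone, the element is zero or has a strictly smaller
      leading exponent, which serves as the bound in the induction hypothesis.\<close>
    have strict: "\<exists>b. a' - b \<in> L \<and> keys (\<Phi> b) \<inter> E = {} \<and> (\<forall>\<mu>\<in>keys (\<Phi> b). le_exp r \<mu> \<nu>)"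
      if le: "\<forall>\<mu>\<in>keys (\<Phi> a'). le_exp r \<mu> \<nu>" and "\<nu> \<notin> keys (\<Phi> a')" for a'
    proof (cases "a' = 0")
      case True
      then show ?thesis
        using L by (intro exI[of _ 0]) (auto simp: left_ideal_def)
    next
      case False
      then obtain \<nu>' where \<nu>': "is_lead r a' \<nu>'"
        using is_lead_exists[OF TO] by blast
      then have "\<nu>' \<in> exponents t" "le_exp r \<nu>' \<nu>" "\<nu>' \<noteq> \<nu>"
        using le that(2) is_lead_in_exponents by (auto simp: is_lead_def)
      moreover from this have "(\<nu>', \<nu>) \<in> inv_image (r - Id) basis"
        using less.prems(1) by (auto simp: le_exp_def basis_inject)
      ultimately obtain b where "a' - b \<in> L" "keys (\<Phi> b) \<inter> E = {}" "\<forall>\<mu>\<in>keys (\<Phi> b). le_exp r \<mu> \<nu>'"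
        using less.IH[of \<nu>' a'] \<nu>' by (auto simp: is_lead_def)
      with \<open>le_exp r \<nu>' \<nu>\<close> show ?thesis
        using le_exp_trans[OF TO] by blast
    qed
    define c where "c = lookup (\<Phi> a) \<nu>"
    show ?case
    proof (cases "\<nu> \<in> E")
      case True
      then obtain g where g: "g \<in> L" "is_lead r g \<nu>" using E by blast
      \<comment> \<open>The factor that cancels the coefficient of \<open>a\<close> at \<nu> against
        the leading coefficient of \<open>g\<close>.\<close>
      define d where "d = c / lookup (\<Phi> g) \<nu>"
      have "lookup (\<Phi> g) \<nu> \<noteq> 0" using g(2) by (simp add: is_lead_def in_keys_iff)
      then have "\<nu> \<notin> keys (\<Phi> (a - scale d g))"
        by (simp add: in_keys_iff lookup_Phi_diff c_def d_def)
      moreover have "\<forall>\<mu>\<in>keys (\<Phi> (a - scale d g)). le_exp r \<mu> \<nu>"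
        using g(2) less.prems(2) by (auto simp: is_lead_def in_keys_iff lookup_Phi_diff)
      ultimately obtain b where b: "a - scale d g - b \<in> L" "keys (\<Phi> b) \<inter> E = {}"
          "\<forall>\<mu>\<in>keys (\<Phi> b). le_exp r \<mu> \<nu>"
        using strict by blast
      have "(a - scale d g - b) + scale d g \<in> L"
        using b(1) left_ideal_scale[OF L g(1)] L unfolding left_ideal_def by blast
      moreover have "(a - scale d g - b) + scale d g = a - b"
        unfolding diff_conv_add_uminus by (simp only: ac_simps) simp
      ultimately have "a - b \<in> L" by simp
      with b show ?thesis by blast
    next
      case False
      \<comment> \<open>The term at \<nu> is allowed in a remainder: it is set aside, the rest is
        reduced, and the term is added back.\<close>
      have "\<nu> \<notin> keys (\<Phi> (a - scale c (basis \<nu>)))"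
        using less.prems(1) by (simp add: in_keys_iff lookup_Phi_diff c_def Phi_basis monom_def)
      moreover have "\<forall>\<mu>\<in>keys (\<Phi> (a - scale c (basis \<nu>))). le_exp r \<mu> \<nu>"
        using less.prems le_exp_refl[OF TO]
        by (auto simp: in_keys_iff lookup_Phi_diff Phi_basis monom_def lookup_single when_def split: if_splits)
      ultimately obtain b where b: "a - scale c (basis \<nu>) - b \<in> L" "keys (\<Phi> b) \<inter> E = {}"
          "\<forall>\<mu>\<in>keys (\<Phi> b). le_exp r \<mu> \<nu>"
        using strict by blast
      have key: "\<mu> \<in> keys (\<Phi> b) \<or> \<mu> = \<nu>" if "\<mu> \<in> keys (\<Phi> (b + scale c (basis \<nu>)))" for \<mu>
        using that less.prems(1)
        by (auto simp: in_keys_iff lookup_Phi_add Phi_basis monom_def lookup_single when_def split: if_splits)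
      have "a - (b + scale c (basis \<nu>)) \<in> L"
        using b(1) by (simp add: algebra_simps)
      moreover have "keys (\<Phi> (b + scale c (basis \<nu>))) \<inter> E = {}"
        using key b(2) False by blast
      moreover have "\<forall>\<mu>\<in>keys (\<Phi> (b + scale c (basis \<nu>))). le_exp r \<mu> \<nu>"
        using key b(3) le_exp_refl[OF TO less.prems(1)] by blast
      ultimately show ?thesis by blast
    qed
  qed
qed

section \<open>Comparison of leading exponents\<close>

definition lead_exps :: "'a rel \<Rightarrow> 'a set \<Rightarrow> (nat \<Rightarrow>\<^sub>0 nat) set" where
  "lead_exps r L = {\<nu>. \<exists>h\<in>L. is_lead r h \<nu>}"

text \<open>An element of \<open>L\<close> is reduced modulo \<open>L'\<close> against the leading
  exponents of \<open>L\<close>, all realised in \<open>L'\<close>. The remainder is again in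
  \<open>L\<close> but contains none of these exponents, so it is zero.\<close>

lemma lead_exps_subset_imp_eq:
  assumes r: "r \<in> WO N" and L: "left_ideal L" "L' \<subseteq> L" "left_ideal L'"
    and E: "lead_exps r L \<subseteq> lead_exps r L'"
  shows "L' = L"
proof
  show "L \<subseteq> L'"
  proof
    fix h assume "h \<in> L"
    have TO: "r \<in> TO N" using r by (simp add: WO_def)
    show "h \<in> L'"
    proof (cases "h = 0")
      case True
      then show ?thesis using L(3) by (simp add: left_ideal_def)
    next
      case False
      then obtain \<nu> where \<nu>: "is_lead r h \<nu>"
        using is_lead_exists[OF TO] by blast
      obtain b where b: "h - b \<in> L'" "keys (\<Phi> b) \<inter> lead_exps r L = {}"
        using normal_form[OF r L(3), of "lead_exps r L" \<nu> h] E \<nu> is_lead_in_exponents[OF \<nu>]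
        by (auto simp: lead_exps_def is_lead_def subset_iff)
      have "h - (h - b) \<in> L"
        using b(1) L(2) left_ideal_diff[OF L(1) \<open>h \<in> L\<close>] by blast
      then have "b \<in> L" by simp
      have "b = 0"
      proof (rule ccontr)
        assume "b \<noteq> 0"
        then obtain \<mu> where "is_lead r b \<mu>"
          using is_lead_exists[OF TO] by blast
        then show False
          using b(2) \<open>b \<in> L\<close> by (auto simp: lead_exps_def is_lead_def)
      qed
      with b(1) show ?thesis by simp
    qed
  qed
qed (fact L(2))

text \<open>The exponents outside \<open>lead_exps r L\<close> index a basis of \<open>A / L\<close> for every \<open>r\<close>, so these sets
  cannot be strictly comparable.\<close>

lemma lead_exps_rigid:
  assumes r: "r \<in> WO N" and r': "r' \<in> WO N" and L: "left_ideal L"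
    and sub: "lead_exps r L \<subseteq> lead_exps r' L"
  shows "lead_exps r' L = lead_exps r L"
proof (rule ccontr)
  assume "lead_exps r' L \<noteq> lead_exps r L"
  then obtain h \<nu> where h: "h \<in> L" "is_lead r' h \<nu>" "\<nu> \<notin> lead_exps r L"
    using sub unfolding lead_exps_def by blast
  define E where "E = lead_exps r L"
  have TO: "r \<in> TO N" "r' \<in> TO N" using r r' by (auto simp: WO_def)
  have \<nu>: "\<nu> \<in> exponents t" using is_lead_in_exponents h(2) .
  define c where "c = lookup (\<Phi> h) \<nu>"
  have "c \<noteq> 0" using h(2) by (simp add: c_def is_lead_def in_keys_iff)
  \<comment> \<open>The leading term of \<open>h\<close> for \<open>r'\<close> is split off; all
    remaining exponents are strictly below \<nu> in \<open>r'\<close>.\<close>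
  define h' where "h' = h - scale c (basis \<nu>)"
  have key: "\<mu> \<noteq> \<nu> \<and> le_exp r' \<mu> \<nu>" if "\<mu> \<in> keys (\<Phi> h')" for \<mu>
    using that h(2) \<nu>
    by (auto simp: h'_def c_def in_keys_iff lookup_Phi_diff Phi_basis monom_def lookup_single
        is_lead_def when_def split: if_splits)
  \<comment> \<open>The tail is reduced with respect to \<open>r'\<close>, but against
    \<open>E\<close>, the leading exponents for \<open>r\<close>; the inclusion \<open>sub\<close>
    provides the reducers. The bound by the leading exponent of \<open>h'\<close> keeps \<nu> out of
    the remainder.\<close>
  have "\<exists>b. h' - b \<in> L \<and> keys (\<Phi> b) \<inter> E = {} \<and> \<nu> \<notin> keys (\<Phi> b)"
  proof (cases "h' = 0")
    case True
    then show ?thesis using L by (intro exI[of _ 0]) (simp add: left_ideal_def)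
  next
    case False
    then obtain \<nu>' where \<nu>': "is_lead r' h' \<nu>'"
      using is_lead_exists[OF TO(2)] by blast
    then have lt: "\<nu>' \<in> exponents t" "\<nu>' \<noteq> \<nu>" "le_exp r' \<nu>' \<nu>"
      using key is_lead_in_exponents[OF \<nu>'] by (auto simp: is_lead_def)
    have "\<exists>b. h' - b \<in> L \<and> keys (\<Phi> b) \<inter> E = {} \<and> (\<forall>\<mu>\<in>keys (\<Phi> b). le_exp r' \<mu> \<nu>')"
    proof (rule normal_form[OF r' L _ lt(1)])
      show "\<exists>g\<in>L. is_lead r' g \<xi>" if "\<xi> \<in> E" for \<xi>
        using that sub by (auto simp: E_def lead_exps_def)
      show "\<forall>\<mu>\<in>keys (\<Phi> h'). le_exp r' \<mu> \<nu>'"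
        using \<nu>' by (simp add: is_lead_def)
    qed
    then obtain b where "h' - b \<in> L" "keys (\<Phi> b) \<inter> E = {}" "\<forall>\<mu>\<in>keys (\<Phi> b). le_exp r' \<mu> \<nu>'"
      by blast
    then show ?thesis
      using le_exp_antisym[OF TO(2) lt(1) \<nu> lt(3)] lt(2) by blast
  qed
  then obtain b where b: "h' - b \<in> L" "keys (\<Phi> b) \<inter> E = {}" "\<nu> \<notin> keys (\<Phi> b)"
    by blast
  \<comment> \<open>\<open>g\<close> equals \<open>h - (h' - b)\<close>, hence lies in
    \<open>L\<close>. Its coefficient at \<nu> is \<open>c\<close>, so it is nonzero, yet all its
    exponents avoid \<open>E\<close>; its leading exponent for \<open>r\<close> gives the
    contradiction.\<close>
  define g where "g = b + scale c (basis \<nu>)"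
  have "h - (h' - b) \<in> L"
    using left_ideal_diff[OF L h(1) b(1)] .
  then have "g \<in> L" by (simp add: g_def h'_def algebra_simps)
  have "lookup (\<Phi> g) \<nu> = c"
    using b(3) \<nu> by (simp add: g_def lookup_Phi_add Phi_basis monom_def in_keys_iff)
  then have "g \<noteq> 0" using \<open>c \<noteq> 0\<close> by auto
  then obtain \<xi> where \<xi>: "is_lead r g \<xi>"
    using is_lead_exists[OF TO(1)] by blast
  have "\<xi> \<in> keys (\<Phi> b) \<or> \<xi> = \<nu>"
    using \<xi> \<nu> by (auto simp: g_def is_lead_def in_keys_iff lookup_Phi_add Phi_basis monom_def
        lookup_single when_def split: if_splits)
  moreover have "\<xi> \<in> E"
    using \<xi> \<open>g \<in> L\<close> by (auto simp: E_def lead_exps_def)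
  ultimately show False
    using b(2) h(3) by (auto simp: E_def)
qed

section \<open>Finite Groebner bases via divisibility of leading exponents\<close>

text \<open>Divisibility form of the statement that the leading monomials of \<open>F\<close>
  generate those of \<open>L\<close>.\<close>

definition lead_complete :: "'a rel \<Rightarrow> 'a set \<Rightarrow> 'a set \<Rightarrow> bool" where
  "lead_complete r L F \<longleftrightarrow>
    (\<forall>\<nu>\<in>lead_exps r L. \<exists>\<mu>\<in>lead_exps r F. \<exists>d\<in>exponents t. \<nu> = \<mu> + d)"

text \<open>Left multiplication by \<open>basis d\<close> stays in the left ideal and shifts leading
  exponents by \<open>d\<close>.\<close>

lemma lead_exps_left_ideal_add:
  assumes "multiplicative_on \<Phi> T" "r \<in> T" "r \<in> TO N" "left_ideal L"
    and "\<mu> \<in> lead_exps r L" "d \<in> exponents t"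
  shows "\<mu> + d \<in> lead_exps r L"
proof -
  obtain g where g: "g \<in> L" "is_lead r g \<mu>"
    using assms(5) by (auto simp: lead_exps_def)
  have "is_lead r (basis d * g) (d + \<mu>)"
    using is_lead_mult[OF assms(1-3) is_lead_basis[OF assms(3,6)] g(2)] .
  moreover have "basis d * g \<in> L"
    using assms(4) g(1) by (simp add: left_ideal_def)
  ultimately show ?thesis
    by (auto simp: lead_exps_def add.commute)
qed

text \<open>Shifting exponents inside \<open>left_span F\<close> reaches every leading exponent of
  \<open>L\<close>, so the span is all of \<open>L\<close>. The leading ideals agree because each
  leading monomial of \<open>L\<close> is a multiple of one from \<open>F\<close>.\<close>

lemma groebner_basis_if_lead_complete:
  assumes mult: "multiplicative_on \<Phi> T" "r \<in> T" and r: "r \<in> WO N" and L: "left_ideal L"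
    and F: "finite F" "F \<subseteq> L" and complete: "lead_complete r L F"
  shows "groebner_basis t \<Phi> r L F"
proof -
  have TO: "r \<in> TO N" using r by (simp add: WO_def)
  have span: "left_span F = L"
  proof (rule lead_exps_subset_imp_eq[OF r L left_span_subset[OF L F(2)] left_ideal_left_span])
    have F_span: "lead_exps r F \<subseteq> lead_exps r (left_span F)"
      using subset_left_span[OF F(1)] by (auto simp: lead_exps_def)
    show "lead_exps r L \<subseteq> lead_exps r (left_span F)"
    proof
      fix \<nu> assume "\<nu> \<in> lead_exps r L"
      then obtain \<mu> d where "\<mu> \<in> lead_exps r F" "d \<in> exponents t" "\<nu> = \<mu> + d"
        using complete unfolding lead_complete_def by blast
      then show "\<nu> \<in> lead_exps r (left_span F)"
        using F_span lead_exps_left_ideal_add[OF mult TO left_ideal_left_span, of \<mu> F d] by blast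
    qed
  qed
  \<comment> \<open>Expresses the generators of a leading ideal through exponents; removing 0
    matches the fact that 0 has no leading exponent.\<close>
  have image: "lead_monom \<Phi> r ` (H - {0}) = monom ` lead_exps r H" for H
  proof
    show "lead_monom \<Phi> r ` (H - {0}) \<subseteq> monom ` lead_exps r H"
    proof
      fix m assume "m \<in> lead_monom \<Phi> r ` (H - {0})"
      then obtain h where h: "h \<in> H" "h \<noteq> 0" "m = lead_monom \<Phi> r h" by auto
      then obtain \<nu> where \<nu>: "is_lead r h \<nu>" using is_lead_exists[OF TO] by blast
      with h show "m \<in> monom ` lead_exps r H"
        using lead_monom_eq[OF TO \<nu>] by (auto simp: lead_exps_def)
    qed
    show "monom ` lead_exps r H \<subseteq> lead_monom \<Phi> r ` (H - {0})"
    proof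
      fix m :: "'k mpoly" assume "m \<in> monom ` lead_exps r H"
      then obtain h \<nu> where h: "h \<in> H" "is_lead r h \<nu>" "m = monom \<nu>"
        by (auto simp: lead_exps_def)
      then have "m = lead_monom \<Phi> r h" "h \<in> H - {0}"
        using lead_monom_eq[OF TO h(2)] is_lead_nonzero[OF h(2)] by auto
      then show "m \<in> lead_monom \<Phi> r ` (H - {0})" by (rule image_eqI)
    qed
  qed
  have poly: "monom ` lead_exps r H \<subseteq> (polynomials t :: 'k mpoly set)" for H
    using is_lead_in_exponents by (auto simp: polynomials_def keys_monom lead_exps_def)
  have "lead_ideal t \<Phi> r L = lead_ideal t \<Phi> r F"
    unfolding lead_ideal_def image
  proof
    have "lead_exps r F \<subseteq> lead_exps r L"
      using F(2) by (auto simp: lead_exps_def)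
    then show "ideal_generated t (monom ` lead_exps r F) \<subseteq>
        (ideal_generated t (monom ` lead_exps r L) :: 'k mpoly set)"
      unfolding ideal_generated_def by (intro hull_mono image_mono)
    have ideal: "is_poly_ideal t (ideal_generated t (monom ` lead_exps r F) :: 'k mpoly set)"
      by (rule is_poly_ideal_ideal_generated[OF poly])
    have "monom ` lead_exps r L \<subseteq> (ideal_generated t (monom ` lead_exps r F) :: 'k mpoly set)"
    proof
      fix m :: "'k mpoly" assume "m \<in> monom ` lead_exps r L"
      then obtain \<nu> where \<nu>: "\<nu> \<in> lead_exps r L" "m = monom \<nu>" by blast
      then obtain \<mu> d where "\<mu> \<in> lead_exps r F" "d \<in> exponents t" "\<nu> = \<mu> + d"
        using complete unfolding lead_complete_def by blast
      with \<nu> have \<mu>: "\<mu> \<in> lead_exps r F" "d \<in> exponents t" "m = monom (\<mu> + d)" by simp_all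
      have "monom \<mu> \<in> (ideal_generated t (monom ` lead_exps r F) :: 'k mpoly set)"
        unfolding ideal_generated_def using \<mu>(1) by (intro hull_inc) simp
      moreover have "monom d \<in> (polynomials t :: 'k mpoly set)"
        using \<mu>(2) by (simp add: polynomials_def keys_monom)
      ultimately have "monom d * monom \<mu> \<in> (ideal_generated t (monom ` lead_exps r F) :: 'k mpoly set)"
        using ideal by (simp add: is_poly_ideal_def)
      then show "m \<in> ideal_generated t (monom ` lead_exps r F)"
        by (simp add: \<mu>(3) monom_mult add.commute)
    qed
    then show "ideal_generated t (monom ` lead_exps r L) \<subseteq>
        (ideal_generated t (monom ` lead_exps r F) :: 'k mpoly set)"
      using ideal unfolding ideal_generated_def by (rule hull_minimal)
  qed
  with span F show ?thesis
    by (simp add: groebner_basis_def)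
qed

text \<open>Dickson's lemma yields finitely many generating exponents; one element of
  \<open>L\<close> is chosen for each.\<close>

lemma finite_lead_complete:
  obtains F where "finite F" "F \<subseteq> L" "lead_complete r L F"
proof -
  have "lead_exps r L \<subseteq> exponents t"
    using is_lead_in_exponents by (auto simp: lead_exps_def)
  from dickson[OF this] obtain D where D: "D \<subseteq> lead_exps r L" "finite D"
      "\<forall>e\<in>lead_exps r L. \<exists>f\<in>D. \<exists>d\<in>exponents t. e = f + d"
    by (elim exE conjE) (rule that)
  from D(1) have "\<forall>\<nu>\<in>D. \<exists>h. h \<in> L \<and> is_lead r h \<nu>"
    by (auto simp: lead_exps_def)
  then obtain h where h: "\<And>\<nu>. \<nu> \<in> D \<Longrightarrow> h \<nu> \<in> L \<and> is_lead r (h \<nu>) \<nu>"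
    by metis
  have "D \<subseteq> lead_exps r (h ` D)"
    using h by (auto simp: lead_exps_def)
  then have "lead_complete r L (h ` D)"
    unfolding lead_complete_def using D(3) by (meson subsetD)
  moreover have "finite (h ` D)" "h ` D \<subseteq> L"
    using D(2) h by auto
  ultimately show ?thesis using that by blast
qed

section \<open>Stability under small changes of the ordering\<close>

text \<open>For \<open>r\<close> in \<open>TO N\<close> the implication already forces equal leading
  exponents on \<open>F\<close>, as these exist and are unique for nonzero elements under both
  orderings.\<close>

definition agree_nbhd :: "'a rel \<Rightarrow> 'a set \<Rightarrow> 'a rel set" where
  "agree_nbhd r F = {r' \<in> TO N. \<forall>f\<in>F. \<forall>\<nu>. is_lead r f \<nu> \<longrightarrow> is_lead r' f \<nu>}"

text \<open>Finite supports and finite \<open>F\<close> leave only finitely many comparisons,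
  collected in \<open>C\<close>, and each of them is a subbasic open condition.\<close>

lemma openin_agree_nbhd:
  assumes "r \<in> TO N" "finite F"
  shows "openin (TO_topology N) (agree_nbhd r F)"
proof -
  define C where "C = (\<Union>f\<in>F. {(\<mu>, \<nu>). \<mu> \<in> keys (\<Phi> f) \<and> \<nu> \<in> keys (\<Phi> f) \<and> is_lead r f \<nu>})"
  have "C \<subseteq> (\<Union>f\<in>F. keys (\<Phi> f) \<times> keys (\<Phi> f))"
    by (auto simp: C_def)
  then have "finite C"
    by (rule finite_subset) (use assms(2) in auto)
  have basic: "openin (TO_topology N) {r' \<in> TO N. le_exp r' \<mu> \<nu>}" if "(\<mu>, \<nu>) \<in> C" for \<mu> \<nu>
  proof -
    have "basis \<mu> \<in> N" "basis \<nu> \<in> N"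
      using that keys_Phi_subset by (auto simp: C_def intro!: basis_in_N)
    then show ?thesis
      unfolding TO_topology_def le_exp_def by (intro topology_generated_by_Basis) blast
  qed
  have "agree_nbhd r F = TO N \<inter> (\<Inter>(\<mu>, \<nu>)\<in>C. {r' \<in> TO N. le_exp r' \<mu> \<nu>})"
    by (fastforce simp: agree_nbhd_def C_def is_lead_def)
  moreover have "openin (TO_topology N) (TO N \<inter> (\<Inter>(\<mu>, \<nu>)\<in>C. {r' \<in> TO N. le_exp r' \<mu> \<nu>}))"
  \<comment> \<open>An empty intersection is the whole type; the factor \<open>TO N\<close> then
    supplies the correct open set.\<close>
  proof (cases "C = {}")
    case True
    then show ?thesis
      using openin_topspace[of "TO_topology N"] by simp
  next
    case False
    then show ?thesis
      using \<open>finite C\<close> basic openin_topspace[of "TO_topology N"]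
      by (intro openin_Int openin_INT2) auto
  qed
  ultimately show ?thesis by simp
qed

text \<open>The exponents of \<open>F\<close> survive the passage to \<open>r'\<close>, and their
  shifts show that every leading exponent of \<open>L\<close> for \<open>r\<close> is one for
  \<open>r'\<close>. Rigidity makes this an equality, so divisibility by exponents of
  \<open>F\<close> carries over.\<close>

lemma lead_complete_agree:
  assumes mult: "multiplicative_on \<Phi> T" "r' \<in> T" and r: "r \<in> WO N" "r' \<in> WO N"
    and L: "left_ideal L" and F: "F \<subseteq> L" "lead_complete r L F" and r': "r' \<in> agree_nbhd r F"
  shows "lead_complete r' L F"
proof -
  have TO: "r' \<in> TO N" using r by (simp add: WO_def)
  have F_sub: "lead_exps r F \<subseteq> lead_exps r' F"
    using r' by (auto simp: agree_nbhd_def lead_exps_def)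
  have F_L: "lead_exps r' F \<subseteq> lead_exps r' L"
    using F(1) by (auto simp: lead_exps_def)
  have "lead_exps r L \<subseteq> lead_exps r' L"
  proof
    fix \<nu> assume "\<nu> \<in> lead_exps r L"
    then obtain \<mu> d where "\<mu> \<in> lead_exps r F" "d \<in> exponents t" "\<nu> = \<mu> + d"
      using F(2) unfolding lead_complete_def by blast
    then show "\<nu> \<in> lead_exps r' L"
      using F_sub F_L lead_exps_left_ideal_add[OF mult TO L, of \<mu> d] by blast
  qed
  then have "lead_exps r' L = lead_exps r L"
    by (rule lead_exps_rigid[OF r L])
  then show ?thesis
    using F(2) F_sub unfolding lead_complete_def by blast
qed

end

section \<open>Extraction of a universal basis by compactness\<close>

theorem theorem10p4:
  fixes scale :: "'k::field \<Rightarrow> 'a::ring_1 \<Rightarrow> 'a"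
    and t :: nat
    and \<Phi> :: "'a \<Rightarrow> 'k mpoly"
    and T :: "'a rel set"
    and L :: "'a set"
  assumes "algebra_of_countable_type scale t \<Phi>"
    and "T \<noteq> {}"
    and "T \<subseteq> WO (canonical_basis t \<Phi>)"
    and "closedin (TO_topology (canonical_basis t \<Phi>)) T"
    and "multiplicative_on \<Phi> T"
    and "left_ideal L"
  shows "\<exists>G. universal_groebner_basis t \<Phi> T L G"
proof -
  interpret algebra_of_countable_type scale t \<Phi> by fact
  have TO: "r \<in> TO N" if "r \<in> T" for r
    using that assms(3) by (auto simp: WO_def)
  have "\<forall>r. \<exists>F. finite F \<and> F \<subseteq> L \<and> lead_complete r L F"
    using finite_lead_complete by metis
  then obtain F where F: "\<And>r. finite (F r)" "\<And>r. F r \<subseteq> L" "\<And>r. lead_complete r L (F r)"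
    by metis
  have comp: "compactin (TO_topology N) T"
    using closed_compactin[OF compactin_TO_topology _ assms(4)] TO by blast
  \<comment> \<open>Each ordering lies in its own neighbourhood, so these open sets cover
    \<open>T\<close>.\<close>
  have "\<exists>\<U>. finite \<U> \<and> \<U> \<subseteq> (\<lambda>r. agree_nbhd r (F r)) ` T \<and> T \<subseteq> \<Union> \<U>"
  proof (rule compactinD[OF comp])
    show "openin (TO_topology N) U" if "U \<in> (\<lambda>r. agree_nbhd r (F r)) ` T" for U
      using that openin_agree_nbhd TO F(1) by auto
    show "T \<subseteq> \<Union> ((\<lambda>r. agree_nbhd r (F r)) ` T)"
      using TO by (auto simp: agree_nbhd_def)
  qed
  then obtain \<U> where U: "finite \<U>" "\<U> \<subseteq> (\<lambda>r. agree_nbhd r (F r)) ` T" "T \<subseteq> \<Union> \<U>"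
    by (elim exE conjE) (rule that)
  obtain R where R: "R \<subseteq> T" "finite R" "\<U> = (\<lambda>r. agree_nbhd r (F r)) ` R"
    using finite_subset_image[OF U(1,2)] by blast
  define G where "G = (\<Union>r\<in>R. F r)"
  have G: "finite G" "G \<subseteq> L"
    using R(2) F by (auto simp: G_def)
  have "groebner_basis t \<Phi> r' L G" if "r' \<in> T" for r'
  proof -
    obtain r where r: "r \<in> R" "r' \<in> agree_nbhd r (F r)"
      using U(3) R(3) \<open>r' \<in> T\<close> by blast
    have WO: "r \<in> WO N" "r' \<in> WO N"
      using r(1) R(1) \<open>r' \<in> T\<close> assms(3) by auto
    have "lead_complete r' L (F r)"
      using lead_complete_agree[OF assms(5) \<open>r' \<in> T\<close> WO assms(6) F(2,3) r(2)] .
    \<comment> \<open>Enlarging \<open>F r\<close> to \<open>G\<close> only adds leading exponents,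
      so completeness for \<open>r'\<close> persists.\<close>
    moreover have "lead_exps r' (F r) \<subseteq> lead_exps r' G"
      using r(1) by (auto simp: G_def lead_exps_def)
    ultimately have "lead_complete r' L G"
      unfolding lead_complete_def by blast
    then show ?thesis
      using groebner_basis_if_lead_complete[OF assms(5) \<open>r' \<in> T\<close> WO(2) assms(6) G] by blast
  qed
  with G have "universal_groebner_basis t \<Phi> T L G"
    by (simp add: universal_groebner_basis_def)
  then show ?thesis ..
qed

end
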